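(* Let $a(s)=s^6+a_1s^5+a_2s^4+a_3s^3+a_4s^2+a_5s+a_6\in H^6$ and $b(s)=s^6+b_1s^5+b_2s^4+b_3s^3+b_4s^2+b_5s+b_6\in H^6$. There exists a polynomial $c(s)$ with real coefficients such that $c(s)/a(s)$ and $c(s)/b(s)$ are both strictly positive real if and only if $$\lambda b(s)+(1-\lambda)a(s)\in H^6\quad\text{for all }\lambda\in[0,1].$$
   Context: $P^n$ denotes the set of polynomials in $s$ of order (degree) $n$ with real coefficients, and $\partial(p)$ denotes the order (degree) of a polynomial $p$. $H^n\subset P^n$ denotes the set of Hurwitz stable polynomials of order $n$ with real coefficients, i.e. those all of whose complex roots have strictly negative real part. $R$ is the field of real numbers and $j=\sqrt{-1}$. Let $p\in P^m$, $q\in P^n$ and $f(s)=p(s)/q(s)$. The rational function $f(s)$ is said to be strictly positive real (SPR) if (i) $\partial(p)=\partial(q)$; (ii) $f(s)$ is analytic in $\mathrm{Re}[s]\ge 0$, namely $q\in H^n$; (iii) $\mathrm{Re}[f(j\omega)]>0$ for all $\omega\in R$. *)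

theory Defs
  imports "HOL-Analysis.Analysis" "HOL-Computational_Algebra.Polynomial"
begin

abbreviation cpoly :: "real poly \<Rightarrow> complex \<Rightarrow> complex" where
  "cpoly p s \<equiv> poly (map_poly complex_of_real p) s"

text \<open>The zero polynomial, which has \<open>degree 0 = 0\<close> in the library, is not in
  \<open>hurwitz 0\<close>, because every complex number is a root of it.\<close>

definition hurwitz :: "nat \<Rightarrow> real poly set" where
  "hurwitz n = {p. degree p = n \<and> (\<forall>s. cpoly p s = 0 \<longrightarrow> Re s < 0)}"

definition ratfun :: "real poly \<Rightarrow> real poly \<Rightarrow> complex \<Rightarrow> complex" where
  "ratfun p q s = cpoly p s / cpoly q s"

text \<open>Strict positive realness refers to the given numerator and denominator, without
  cancelling common factors. The requirement that \<open>p/q\<close> be analytic in the closed right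
  half-plane is imposed in the form that \<open>q\<close> is Hurwitz stable; the lemma below derives the
  analyticity.\<close>

definition strictly_positive_real :: "real poly \<Rightarrow> real poly \<Rightarrow> bool" where
  "strictly_positive_real p q \<longleftrightarrow>
     degree p = degree q \<and>
     q \<in> hurwitz (degree q) \<and>
     (\<forall>\<omega>::real. Re (ratfun p q (\<i> * complex_of_real \<omega>)) > 0)"

lemma strictly_positive_real_analytic:
  assumes "strictly_positive_real p q"
  shows "ratfun p q analytic_on {s. Re s \<ge> 0}"
proof -
  have nz: "cpoly q s \<noteq> 0" if "Re s \<ge> 0" for s
    using assms that by (force simp: strictly_positive_real_def hurwitz_def)
  have poly_analytic: "poly r analytic_on S" for r :: "complex poly" and S
    by (meson analytic_on_holomorphic holomorphic_on_def field_differentiable_at_within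
        field_differentiable_def poly_DERIV open_UNIV subset_UNIV)
  have "(\<lambda>s. cpoly p s / cpoly q s) analytic_on {s. Re s \<ge> 0}"
    by (intro analytic_on_divide poly_analytic) (use nz in auto)
  then show ?thesis
    by (simp add: ratfun_def[abs_def])
qed

end

(* Write x = omega^2 and a(i omega) = A0(x) + i omega A1(x), and likewise for b and c. Then c/a and
   c/b are strictly positive real iff F = A0 C0 + x A1 C1 and H = B0 C0 + x B1 C1 are positive on
   [0, oo) and the degrees match.

   Sufficiency: let D = A0 B1 - A1 B0 and let T be the set of its sign changes on (0, oo). At the
   zeros of x D the stability of the segment forces a(i omega) and b(i omega) to have the same
   argument, B = kappa A with kappa > 0. Prescribing F = P E and H = Q E with D = E prod_T (x - t),
   Cramer's rule gives polynomials C0, C1 of the right degrees as soon as Q = kappa P on T and at 0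
   and P, Q have equal coefficients in degree card T + 1. Such P = u^2 + x u'^2 and
   Q = v^2 + x v'^2 are found by solving the linear equations v = +- sqrt(kappa) u with signs that
   alternate along the nodes; the alternation keeps the Wronskian-like polynomial u v' + v u' from
   vanishing identically, so it vanishes only on T, and P, Q are positive elsewhere. Where H still
   vanishes the arguments of a and b agree, so adding a small multiple of a to c finishes the
   construction.

   Necessity: by the maximum principle Re(c/a) and Re(c/b) are positive on the closed right
   half-plane, hence c times the conjugate of l b + (1 - l) a has positive real part there. *)

theory Submission
  imports Defs "HOL-Complex_Analysis.Complex_Analysis"
begin

section \<open>Alternating interpolation\<close>

lemma homogeneous_system_nontrivial:
  fixes M :: "'i \<Rightarrow> 'j \<Rightarrow> 'a::field"
  assumes "finite I" "finite J" "card I < card J"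
  shows "\<exists>x. (\<exists>j\<in>J. x j \<noteq> 0) \<and> (\<forall>i\<in>I. (\<Sum>j\<in>J. M i j * x j) = 0)"
  using assms
proof (induction I arbitrary: J M rule: finite_induct)
  case empty
  then have "J \<noteq> {}" by auto
  then show ?case by (intro exI[of _ "\<lambda>_. 1"]) auto
next
  case (insert i0 I)
  show ?case
  proof (cases "\<forall>j\<in>J. M i0 j = 0")
    case True
    obtain x where "\<exists>j\<in>J. x j \<noteq> 0" "\<forall>i\<in>I. (\<Sum>j\<in>J. M i j * x j) = 0"
      using insert.IH[of J M] insert.prems insert.hyps by auto
    with True show ?thesis by (intro exI[of _ x]) auto
  next
    case False
    then obtain p where p: "p \<in> J" "M i0 p \<noteq> 0" by auto
    define K where "K = J - {p}"
    \<comment> \<open>Gaussian elimination with pivot \<open>M i0 p\<close>: solving equation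
      \<open>i0\<close> for \<open>x p\<close> and substituting leaves the system \<open>M'\<close>
      in the unknowns \<open>K\<close>, with one equation and one unknown fewer.\<close>
    define M' where "M' = (\<lambda>i j. M i j - M i p * M i0 j / M i0 p)"
    have K: "finite K" "p \<notin> K" "card I < card K"
      using insert p by (auto simp: K_def)
    have J: "(\<Sum>j\<in>J. f j) = f p + (\<Sum>j\<in>K. f j)" for f :: "'j \<Rightarrow> 'a"
      using insert.prems p unfolding K_def by (intro sum.remove) auto
    obtain x where x: "\<exists>j\<in>K. x j \<noteq> 0" "\<forall>i\<in>I. (\<Sum>j\<in>K. M' i j * x j) = 0"
      using insert.IH[of K M'] K by auto
    define y where "y = x(p := - (\<Sum>j\<in>K. M i0 j * x j) / M i0 p)"
    have yK: "(\<Sum>j\<in>K. M i j * y j) = (\<Sum>j\<in>K. M i j * x j)" for i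
      using K by (intro sum.cong) (auto simp: y_def)
    have *: "(\<Sum>j\<in>J. M i j * y j) = (\<Sum>j\<in>K. M' i j * x j)" for i
      unfolding J yK M'_def
      by (simp add: y_def algebra_simps sum_subtractf sum_distrib_left sum_divide_distrib)
    have "(\<Sum>j\<in>K. M' i0 j * x j) = 0"
      using p by (simp add: M'_def)
    with x have "\<forall>i\<in>insert i0 I. (\<Sum>j\<in>J. M i j * y j) = 0"
      by (simp add: *)
    moreover have "\<exists>j\<in>J. y j \<noteq> 0"
      using x K by (auto simp: y_def K_def)
    ultimately show ?thesis by blast
  qed
qed

lemma prod_eq_sign_prod_abs:
  fixes f :: "'a \<Rightarrow> 'b::linordered_idom"
  assumes "finite S"
  shows "(\<Prod>j\<in>S. f j) = (- 1) ^ card {j\<in>S. f j < 0} * (\<Prod>j\<in>S. \<bar>f j\<bar>)"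
  using assms
proof (induction S rule: finite_induct)
  case (insert i S)
  have "{j \<in> insert i S. f j < 0} = (if f i < 0 then insert i {j\<in>S. f j < 0} else {j\<in>S. f j < 0})"
    by auto
  with insert show ?case by (auto simp: abs_if)
qed simp

lemma coeff_mult_top:
  fixes p q :: "'a::comm_semiring_0 poly"
  assumes "degree p \<le> m" "degree q \<le> n"
  shows "coeff (p * q) (m + n) = coeff p m * coeff q n"
proof -
  have "coeff (p * q) (m + n) = (\<Sum>i\<le>m + n. coeff p i * coeff q (m + n - i))"
    by (rule coeff_mult)
  also have "\<dots> = (\<Sum>i\<in>{m}. coeff p i * coeff q (m + n - i))"
  proof (rule sum.mono_neutral_right)
    show "\<forall>i\<in>{..m + n} - {m}. coeff p i * coeff q (m + n - i) = 0"
    proof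
      fix i assume "i \<in> {..m + n} - {m}"
      then have "degree p < i \<or> degree q < m + n - i" using assms by auto
      then show "coeff p i * coeff q (m + n - i) = 0" by (auto simp: coeff_eq_0)
    qed
  qed auto
  finally show ?thesis by simp
qed

lemma degree_prod_linear: "degree (\<Prod>t\<in>T. [:- t, 1::'a::idom:]) = card T"
  by (subst degree_prod_sum_eq) auto

lemma lead_coeff_prod_linear: "coeff (\<Prod>t\<in>T. [:- t, 1::'a::idom:]) (card T) = 1"
proof -
  have "lead_coeff (\<Prod>t\<in>T. [:- t, 1::'a:]) = 1"
    by (simp add: lead_coeff_prod)
  then show ?thesis by (simp add: degree_prod_linear)
qed

text \<open>The degree may be one higher than the values on \<open>T\<close> alone determine; the
  coefficient at \<open>card T\<close> supplies the missing datum, like a value at infinity. The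
  formula splits \<open>poly h x\<close> into terms whose signs can be read off factor by
  factor.\<close>

lemma lagrange_interpolation:
  fixes h :: "'a::field poly"
  assumes "finite T" and "degree h \<le> card T"
  shows "poly h x = coeff h (card T) * (\<Prod>j\<in>T. x - j) +
           (\<Sum>t\<in>T. poly h t * (\<Prod>j\<in>T - {t}. (x - j) / (t - j)))"
proof -
  define L where "L = (\<lambda>t. \<Prod>j\<in>T - {t}. [:- j, 1:])"
  define c where "c = (\<lambda>t. poly h t / (\<Prod>j\<in>T - {t}. t - j))"
  define g where "g = smult (coeff h (card T)) (\<Prod>j\<in>T. [:- j, 1:]) + (\<Sum>t\<in>T. smult (c t) (L t))"
  have dL: "degree (L t) < card T" if "t \<in> T" for t
  proof -
    have "card T > 0" using that assms by (auto simp: card_gt_0_iff)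
    then show ?thesis using that by (simp add: L_def degree_prod_linear)
  qed
  have "h = g"
  proof (rule poly_eqI_degree_lead_coeff[of _ "card T" _ T])
    have "degree (\<Sum>t\<in>T. smult (c t) (L t)) \<le> card T"
      using dL by (intro degree_sum_le assms) (auto intro: order.trans[OF degree_smult_le] less_imp_le)
    then show "degree g \<le> card T"
      unfolding g_def
      by (intro degree_add_le) (auto simp: degree_prod_linear)
    show "coeff h (card T) = coeff g (card T)"
      using dL by (auto simp: g_def coeff_sum lead_coeff_prod_linear coeff_eq_0)
    show "poly h z = poly g z" if "z \<in> T" for z
    proof -
      have "poly (L t) z = 0" if "t \<in> T - {z}" for t
        using that \<open>z \<in> T\<close> assms by (auto simp: L_def poly_prod)
      then have "(\<Sum>t\<in>T. c t * poly (L t) z) = c z * poly (L z) z"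
        using that assms by (subst sum.remove[of T z]) (auto intro!: sum.neutral)
      moreover have "c z * poly (L z) z = poly h z"
        using assms by (simp add: c_def L_def poly_prod)
      moreover have "(\<Prod>j\<in>T. z - j) = 0"
        using that assms by auto
      ultimately show ?thesis by (simp add: g_def poly_sum poly_prod)
    qed
  qed (use assms in auto)
  then have "poly h x = poly g x" by simp
  also have "\<dots> = coeff h (card T) * (\<Prod>j\<in>T. x - j) +
      (\<Sum>t\<in>T. poly h t * (\<Prod>j\<in>T - {t}. (x - j) / (t - j)))"
    by (simp add: g_def c_def L_def poly_sum poly_prod prod_dividef)
  finally show ?thesis .
qed

section \<open>Sign alternation along a finite set of nodes\<close>

definition rank_in :: "real set \<Rightarrow> real \<Rightarrow> nat" where
  "rank_in T t = card {j\<in>T. j < t}"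

text \<open>The sign \<open>(- 1) ^ rank_in T t\<close> alternates along the nodes, starting with
  plus at the smallest. To the left of all nodes the factor \<open>(x - j) / (t - j)\<close> is
  negative exactly when \<open>j < t\<close>, so the Lagrange basis polynomial of \<open>t\<close>
  has this same sign there. All terms of the interpolation formula are then nonnegative, and their
  sum is zero only if all data vanish, that is, if \<open>h = 0\<close>.\<close>

lemma alternating_values_extrapolate:
  fixes h :: "real poly"
  assumes T: "finite T" and deg: "degree h \<le> card T"
    and alt: "\<And>t. t \<in> T \<Longrightarrow> 0 \<le> (- 1) ^ rank_in T t * poly h t"
    and inf: "0 \<le> (- 1) ^ card T * coeff h (card T)"
    and x: "\<And>t. t \<in> T \<Longrightarrow> x < t"
    and nz: "h \<noteq> 0"
  shows "0 < poly h x"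
proof -
  define w where "w = (\<lambda>t. \<Prod>j\<in>T - {t}. \<bar>(x - j) / (t - j)\<bar>)"
  have w: "w t > 0" if "t \<in> T" for t
  proof (unfold w_def, rule prod_pos)
    fix j assume "j \<in> T - {t}"
    then have "x - j \<noteq> 0" "t - j \<noteq> 0" using x[of j] by auto
    then show "0 < \<bar>(x - j) / (t - j)\<bar>" by simp
  qed
  have sgn: "(\<Prod>j\<in>T - {t}. (x - j) / (t - j)) = (- 1) ^ rank_in T t * w t" if "t \<in> T" for t
  proof -
    have "{j \<in> T - {t}. (x - j) / (t - j) < 0} = {j\<in>T. j < t}"
      using x that by (force simp: divide_less_0_iff)
    then show ?thesis
      using T by (subst prod_eq_sign_prod_abs) (simp_all add: w_def rank_in_def)
  qed
  have sgn': "(\<Prod>j\<in>T. x - j) = (- 1) ^ card T * (\<Prod>j\<in>T. \<bar>x - j\<bar>)"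
  proof -
    have "{j \<in> T. x - j < 0} = T" using x by auto
    then show ?thesis
      using T by (subst prod_eq_sign_prod_abs) simp_all
  qed
  define W where "W = (\<Prod>j\<in>T. \<bar>x - j\<bar>)"
  have W: "W > 0"
    unfolding W_def using x by (intro prod_pos) force
  have eq: "poly h x = ((- 1) ^ card T * coeff h (card T)) * W +
      (\<Sum>t\<in>T. ((- 1) ^ rank_in T t * poly h t) * w t)"
    unfolding lagrange_interpolation[OF T deg, of x] sgn' W_def
    by (intro arg_cong2[of _ _ _ _ "(+)"] sum.cong) (auto simp: sgn)
  have nn: "0 \<le> ((- 1) ^ rank_in T t * poly h t) * w t" if "t \<in> T" for t
    using alt[OF that] w[OF that] by simp
  have "poly h x \<ge> 0"
    unfolding eq using inf W by (intro add_nonneg_nonneg sum_nonneg nn) auto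
  moreover have "poly h x \<noteq> 0"
  proof
    assume "poly h x = 0"
    moreover have "0 \<le> ((- 1) ^ card T * coeff h (card T)) * W"
      using inf W by simp
    moreover have "0 \<le> (\<Sum>t\<in>T. ((- 1) ^ rank_in T t * poly h t) * w t)"
      by (intro sum_nonneg nn)
    ultimately have 0: "(- 1) ^ card T * coeff h (card T) * W = 0"
      and S: "(\<Sum>t\<in>T. ((- 1) ^ rank_in T t * poly h t) * w t) = 0"
      unfolding eq by linarith+
    have "h = 0"
    proof (rule poly_eqI_degree_lead_coeff[of _ "card T" _ T])
      show "coeff h (card T) = coeff 0 (card T)" using 0 W by simp
      show "poly h z = poly 0 z" if "z \<in> T" for z
        using S that w[OF that] nn by (subst (asm) sum_nonneg_eq_0_iff[OF T]) auto
    qed (use deg in auto)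
    with nz show False ..
  qed
  ultimately show ?thesis by simp
qed

text \<open>For an even number of nodes the condition on the leading coefficients plays the role of
  one more node at infinity, so that there are always \<open>2 k + 1\<close> equations for \<open>2 k + 2\<close>
  coefficients, where \<open>k = card T div 2\<close>.\<close>

lemma alternating_pair:
  fixes T :: "real set" and s :: "real \<Rightarrow> real"
  assumes T: "finite T" and s: "\<And>t. t \<in> T \<Longrightarrow> s t > 0"
  obtains u v :: "real poly"
  where "degree u \<le> card T div 2" "degree v \<le> card T div 2"
    and "\<And>t. t \<in> T \<Longrightarrow> poly v t = (- 1) ^ rank_in T t * s t * poly u t"
    and "even (card T) \<Longrightarrow> coeff v (card T div 2) = coeff u (card T div 2)"
    and "\<And>x. (\<And>t. t \<in> T \<Longrightarrow> x < t) \<Longrightarrow> 0 < poly u x * poly v x"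
proof -
  define k where "k = card T div 2"
  define e where "e = (\<lambda>t. (- 1) ^ rank_in T t * s t)"
  define I where "I = Some ` T \<union> (if even (card T) then {None} else {})"
  define J where "J = {..k} <+> {..k}"
  \<comment> \<open>The unknowns \<open>Inl n\<close> and \<open>Inr n\<close> are the coefficients
    of \<open>u\<close> and \<open>v\<close>. Row \<open>Some t\<close> expresses
    \<open>v = e u\<close> at the node \<open>t\<close>, and row \<open>None\<close> expresses
    equality of the coefficients in degree \<open>k\<close>.\<close>
  define M :: "real option \<Rightarrow> nat + nat \<Rightarrow> real" where
    "M = (\<lambda>i j. case (i, j) of
        (Some t, Inl n) \<Rightarrow> - e t * t ^ n
      | (Some t, Inr n) \<Rightarrow> t ^ n
      | (None, Inl n) \<Rightarrow> if n = k then - 1 else 0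
      | (None, Inr n) \<Rightarrow> if n = k then 1 else 0)"
  have "card I < card J"
  proof -
    have "card I = card T + (if even (card T) then 1 else 0)"
      using T by (auto simp: I_def card_image card_insert_if)
    also have "\<dots> < card J"
    proof -
      have "card T < 2 * (card T div 2) + 2" "even (card T) \<Longrightarrow> card T = 2 * (card T div 2)"
        by auto
      then show ?thesis by (auto simp: J_def card_Plus k_def)
    qed
    finally show ?thesis .
  qed
  moreover have "finite I" "finite J" using T by (auto simp: I_def J_def)
  ultimately obtain x where x: "\<exists>j\<in>J. x j \<noteq> 0" "\<And>i. i \<in> I \<Longrightarrow> (\<Sum>j\<in>J. M i j * x j) = 0"
    using homogeneous_system_nontrivial[of I J M] by blast
  define u v where "u = (\<Sum>n\<le>k. monom (x (Inl n)) n)" and "v = (\<Sum>n\<le>k. monom (x (Inr n)) n)"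
  have cu: "coeff u n = (if n \<le> k then x (Inl n) else 0)"
    and cv: "coeff v n = (if n \<le> k then x (Inr n) else 0)" for n
    by (auto simp: u_def v_def coeff_sum)
  have du: "degree u \<le> k" and dv: "degree v \<le> k"
    by (auto intro!: degree_le simp: cu cv)
  have uv: "poly v t = e t * poly u t" if "t \<in> T" for t
    using x(2)[of "Some t"] that
    by (simp add: I_def J_def M_def sum.Plus u_def v_def poly_sum poly_monom
        sum_distrib_left mult.commute mult.left_commute sum_negf)
  have lc: "coeff v k = coeff u k" if "even (card T)"
    using x(2)[of None] that
    by (simp add: I_def J_def M_def sum.Plus cu cv if_distrib if_distribR sum.delta cong: if_cong)
  have nz: "u \<noteq> 0 \<or> v \<noteq> 0"
  proof -
    obtain j where "j \<in> J" "x j \<noteq> 0" using x by blast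
    then have "\<exists>n. coeff u n \<noteq> 0 \<or> coeff v n \<noteq> 0"
      by (force simp: J_def cu cv)
    then show ?thesis by auto
  qed
  \<comment> \<open>A nontrivial solution only makes one of \<open>u\<close>, \<open>v\<close>
    nonzero. If one of them were zero, the other would vanish on \<open>T\<close>, and for even
    \<open>card T\<close> also in its coefficient \<open>k\<close>, which is too much for degree at
    most \<open>k\<close>.\<close>
  have zero: "p = 0" if "degree p \<le> k" "\<And>t. t \<in> T \<Longrightarrow> poly p t = 0" "even (card T) \<Longrightarrow> coeff p k = 0"
    for p :: "real poly"
  proof (rule poly_eqI_degree_lead_coeff[of p "card T div 2" 0 T])
    show "coeff p (card T div 2) = coeff 0 (card T div 2)"
    proof (cases "even (card T)")
      case False
      then have "p = 0"
        using that T by (intro poly_eqI_degree[of T]) (auto simp: k_def intro: le_less_trans elim!: oddE)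
      then show ?thesis by simp
    qed (use that in \<open>auto simp: k_def\<close>)
  qed (use that in \<open>auto simp: k_def\<close>)
  have e: "e t \<noteq> 0" if "t \<in> T" for t
    using s[OF that] by (simp add: e_def)
  have "u \<noteq> 0 \<and> v \<noteq> 0"
    using nz zero[OF du] zero[OF dv] uv e lc by auto
  then have h0: "u * v \<noteq> 0" by simp
  \<comment> \<open>The product \<open>u * v\<close> has alternating values, since at a node it
    equals the prescribed sign times \<open>s t\<close> times a square. For even
    \<open>card T\<close> its top coefficient is a square as well.\<close>
  have "0 < poly u x * poly v x" if "\<And>t. t \<in> T \<Longrightarrow> x < t" for x
  proof -
    have d2: "degree (u * v) \<le> 2 * k"
      using degree_mult_le[of u v] du dv by linarith
    have "0 < poly (u * v) x"
    proof (rule alternating_values_extrapolate[OF T])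
      show "degree (u * v) \<le> card T" using d2 by (simp add: k_def)
      show "0 \<le> (- 1) ^ rank_in T t * poly (u * v) t" if "t \<in> T" for t
      proof -
        have "(- 1) ^ rank_in T t * poly (u * v) t = ((- 1) ^ rank_in T t)\<^sup>2 * (s t * (poly u t)\<^sup>2)"
          using uv[OF that] by (simp add: e_def power2_eq_square algebra_simps)
        then show ?thesis using s[OF that] by simp
      qed
      show "0 \<le> (- 1) ^ card T * coeff (u * v) (card T)"
      proof (cases "even (card T)")
        case True
        then have "coeff (u * v) (card T) = coeff u k * coeff v k"
          using coeff_mult_top[OF du dv] by (auto simp: k_def mult_2 elim!: evenE)
        with True lc show ?thesis by simp
      next
        case False
        then have "degree (u * v) < card T" using d2 by (auto simp: k_def elim!: oddE)
        then show ?thesis by (simp add: coeff_eq_0)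
      qed
    qed (use that h0 in auto)
    then show ?thesis by simp
  qed
  with du dv uv lc show ?thesis
    by (intro that[of u v]) (auto simp: k_def e_def)
qed

text \<open>Squaring removes the signs in \<open>v = +- sqrt (\<kappa> t) u\<close>, so that
  \<open>Q = \<kappa> P\<close> at the nodes. Two alternating pairs are combined: one on
  \<open>insert 0 T\<close> for the plain squares, one on \<open>T\<close> for the squares
  multiplied by \<open>x\<close>, where the node 0 needs no second condition.\<close>

lemma interlacing_pair:
  fixes T :: "real set" and \<kappa> :: "real \<Rightarrow> real"
  assumes T: "finite T" "T \<subseteq> {0<..}" and \<kappa>: "\<And>t. t \<in> insert 0 T \<Longrightarrow> \<kappa> t > 0"
  obtains P Q :: "real poly"
  where "degree P \<le> Suc (card T)" "degree Q \<le> Suc (card T)"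
    and "coeff P (Suc (card T)) = coeff Q (Suc (card T))"
    and "\<forall>t\<in>insert 0 T. poly Q t = \<kappa> t * poly P t"
    and "\<forall>x\<ge>0. 0 \<le> poly P x \<and> 0 \<le> poly Q x"
    and "\<forall>x>0. x \<notin> T \<longrightarrow> 0 < poly P x \<and> 0 < poly Q x"
proof -
  define s where "s = (\<lambda>t. sqrt (\<kappa> t))"
  define r where "r = card T"
  have s: "s t > 0" "(s t)\<^sup>2 = \<kappa> t" if "t \<in> insert 0 T" for t
    using \<kappa>[OF that] by (auto simp: s_def)
  have T0: "0 \<notin> T" using T by auto
  have card0: "card (insert 0 T) = Suc r" using T T0 by (simp add: r_def)
  have rank0: "rank_in (insert 0 T) 0 = 0"
    using T by (force simp: rank_in_def)
  have rank_Suc: "rank_in (insert 0 T) t = Suc (rank_in T t)" if "t \<in> T" for t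
  proof -
    have "{j \<in> insert 0 T. j < t} = insert 0 {j \<in> T. j < t}" using T that by auto
    then show ?thesis using T T0 by (simp add: rank_in_def)
  qed
  obtain u v where uv: "degree u \<le> Suc r div 2" "degree v \<le> Suc r div 2"
    "\<And>t. t \<in> insert 0 T \<Longrightarrow> poly v t = (- 1) ^ rank_in (insert 0 T) t * s t * poly u t"
    "even (Suc r) \<Longrightarrow> coeff v (Suc r div 2) = coeff u (Suc r div 2)"
    "\<And>x. (\<And>t. t \<in> insert 0 T \<Longrightarrow> x < t) \<Longrightarrow> 0 < poly u x * poly v x"
    using alternating_pair[of "insert 0 T" s] T s(1) unfolding card0 by blast
  obtain u' v' where uv': "degree u' \<le> r div 2" "degree v' \<le> r div 2"
    "\<And>t. t \<in> T \<Longrightarrow> poly v' t = (- 1) ^ rank_in T t * s t * poly u' t"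
    "even r \<Longrightarrow> coeff v' (r div 2) = coeff u' (r div 2)"
    "\<And>x. (\<And>t. t \<in> T \<Longrightarrow> x < t) \<Longrightarrow> 0 < poly u' x * poly v' x"
    using alternating_pair[of T s] T s(1) unfolding r_def by blast
  \<comment> \<open>The extra node 0 raises every rank by one, so at each \<open>t\<close> in
    \<open>T\<close> the two pairs carry opposite signs and the two products cancel. A common zero
    of \<open>u\<close> and \<open>u'\<close>, or of \<open>v\<close> and \<open>v'\<close>, is a
    zero of \<open>W\<close>; as \<open>W\<close> has degree at most \<open>card T\<close>, it has
    no zeros outside \<open>T\<close> unless it vanishes identically.\<close>
  define W where "W = u * v' + v * u'"
  have degW: "degree W \<le> r"
  proof -
    have "degree (u * v') \<le> r" "degree (v * u') \<le> r"
      using degree_mult_le[of u v'] degree_mult_le[of v u'] uv(1,2) uv'(1,2) by linarith+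
    then show ?thesis unfolding W_def by (intro degree_add_le)
  qed
  have WT: "poly W t = 0" if "t \<in> T" for t
    using uv(3)[of t] uv'(3)[of t] rank_Suc[OF that] that by (simp add: W_def)
  have W0: "W \<noteq> 0"
  proof
    assume "W = 0"
    \<comment> \<open>The point -1 lies to the left of 0 and of \<open>T\<close>, so
      \<open>u * v\<close> and \<open>u' * v'\<close> are positive there, and hence so is
      \<open>u * u' * W\<close>.\<close>
    have *: "0 < poly u (- 1) * poly v (- 1)" "0 < poly u' (- 1) * poly v' (- 1)"
      using T by (intro uv(5) uv'(5); force)+
    have "poly u (- 1) * poly u' (- 1) * poly W (- 1) =
        (poly u (- 1))\<^sup>2 * (poly u' (- 1) * poly v' (- 1)) + (poly u' (- 1))\<^sup>2 * (poly u (- 1) * poly v (- 1))"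
      by (simp add: W_def power2_eq_square algebra_simps)
    moreover have "0 < (poly u (- 1))\<^sup>2 * (poly u' (- 1) * poly v' (- 1))"
      using *(1) by (intro mult_pos_pos[OF _ *(2)]) auto
    moreover have "0 < (poly u' (- 1))\<^sup>2 * (poly u (- 1) * poly v (- 1))"
      using *(2) by (intro mult_pos_pos[OF _ *(1)]) auto
    ultimately show False using \<open>W = 0\<close> by simp
  qed
  have Wx: "poly W x \<noteq> 0" if "x \<notin> T" for x
  proof
    assume "poly W x = 0"
    then have "W = 0"
      using WT that T degW by (intro poly_eqI_degree[of "insert x T"]) (auto simp: r_def)
    with W0 show False ..
  qed
  define P Q where "P = u * u + pCons 0 (u' * u')" and "Q = v * v + pCons 0 (v' * v')"
  have P: "poly P x = (poly u x)\<^sup>2 + x * (poly u' x)\<^sup>2"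
    and Q: "poly Q x = (poly v x)\<^sup>2 + x * (poly v' x)\<^sup>2" for x
    by (auto simp: P_def Q_def power2_eq_square)
  have deg: "degree (p * p + pCons 0 (q * q)) \<le> Suc r"
    if "degree p \<le> Suc r div 2" "degree q \<le> r div 2" for p q :: "real poly"
  proof (intro degree_add_le)
    show "degree (p * p) \<le> Suc r" using degree_mult_le[of p p] that by linarith
    have "degree (q * q) \<le> r" using degree_mult_le[of q q] that by linarith
    then show "degree (pCons 0 (q * q)) \<le> Suc r"
      by (intro order.trans[OF degree_pCons_le]) auto
  qed
  \<comment> \<open>Only one of the two squares can reach degree \<open>Suc r\<close>: the shifted
    one for even \<open>r\<close>, the other for odd \<open>r\<close>. In either case the
    corresponding pair has equal leading data.\<close>
  have lead: "coeff (p * p + pCons 0 (q * q)) (Suc r) =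
      (if even r then (coeff q (r div 2))\<^sup>2 else (coeff p (Suc r div 2))\<^sup>2)"
    if "degree p \<le> Suc r div 2" "degree q \<le> r div 2" for p q :: "real poly"
  proof (cases "even r")
    case True
    then obtain k where "r = 2 * k" by (rule evenE)
    with that coeff_mult_top[of q k q k] degree_mult_le[of p p] show ?thesis
      by (simp add: mult_2 power2_eq_square coeff_eq_0)
  next
    case False
    then obtain k where "r = 2 * k + 1" by (rule oddE)
    with that coeff_mult_top[of p "Suc k" p "Suc k"] degree_mult_le[of q q] show ?thesis
      by (simp add: mult_2 power2_eq_square coeff_eq_0)
  qed
  show ?thesis
  proof (rule that[of P Q])
    show "degree P \<le> Suc (card T)" "degree Q \<le> Suc (card T)"
      using deg uv(1,2) uv'(1,2) by (auto simp: P_def Q_def r_def)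
    show "coeff P (Suc (card T)) = coeff Q (Suc (card T))"
      using uv(4) uv'(4) unfolding P_def Q_def r_def[symmetric]
      by (subst (1 2) lead) (use uv(1,2) uv'(1,2) in auto)
    show "\<forall>t\<in>insert 0 T. poly Q t = \<kappa> t * poly P t"
    proof
      fix t assume t: "t \<in> insert 0 T"
      show "poly Q t = \<kappa> t * poly P t"
      proof (cases "t \<in> T")
        case True
        then show ?thesis
          using uv(3)[of t] uv'(3)[of t] s(2)[of t]
          by (simp add: P Q power_mult_distrib algebra_simps flip: power_mult)
      next
        case False
        then have "t = 0" using t by auto
        then show ?thesis
          using uv(3)[of 0] s(2)[of 0] by (simp add: P Q power_mult_distrib rank0)
      qed
    qed
    show "\<forall>x>0. x \<notin> T \<longrightarrow> 0 < poly P x \<and> 0 < poly Q x"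
    proof (intro allI impI)
      fix x :: real assume x: "0 < x" "x \<notin> T"
      have "poly u x \<noteq> 0 \<or> poly u' x \<noteq> 0" "poly v x \<noteq> 0 \<or> poly v' x \<noteq> 0"
        using Wx[OF x(2)] by (auto simp: W_def)
      then show "0 < poly P x \<and> 0 < poly Q x"
        using x by (auto simp: P Q intro: add_pos_nonneg add_nonneg_pos)
    qed
  qed (auto simp: P Q)
qed

section \<open>The numerator up to positivity\<close>

lemma prod_linear_dvd:
  fixes p :: "'a::idom poly"
  assumes "finite T" "\<And>t. t \<in> T \<Longrightarrow> poly p t = 0"
  shows "(\<Prod>t\<in>T. [:- t, 1:]) dvd p"
  using assms
proof (induction T arbitrary: p rule: finite_induct)
  case (insert t T)
  then obtain q where q: "p = [:- t, 1:] * q"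
    by (metis dvdE insertI1 poly_eq_0_iff_dvd)
  have "poly q s = 0" if "s \<in> T" for s
    using insert.prems[of s] insert.hyps that by (auto simp: q)
  then show ?case
    using insert by (simp add: q mult_dvd_mono del: mult_pCons_left)
qed simp

text \<open>As long as \<open>D\<close> takes both signs on the half-line, the intermediate value
  theorem yields a positive root \<open>z\<close> to split off. If \<open>z\<close> already belongs
  to the set obtained for the quotient, the two factors form a square that goes into
  \<open>E\<close>; otherwise \<open>z\<close> joins the set.\<close>

lemma sign_change_factorization:
  fixes D :: "real poly"
  assumes "D \<noteq> 0"
  obtains E T where "finite T" "T \<subseteq> {0<..}" "D = E * (\<Prod>t\<in>T. [:- t, 1:])"
    and "(\<forall>x\<ge>0. 0 \<le> poly E x) \<or> (\<forall>x\<ge>0. poly E x \<le> 0)"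
proof -
  have "\<exists>E T. finite T \<and> T \<subseteq> {0<..} \<and> D = E * (\<Prod>t\<in>T. [:- t, 1:]) \<and>
      ((\<forall>x\<ge>0. 0 \<le> poly E x) \<or> (\<forall>x\<ge>0. poly E x \<le> 0))"
    using assms
  proof (induction "degree D" arbitrary: D rule: less_induct)
    case less
    show ?case
    proof (cases "(\<forall>x\<ge>0. 0 \<le> poly D x) \<or> (\<forall>x\<ge>0. poly D x \<le> 0)")
      case True
      then show ?thesis by (intro exI[of _ D] exI[of _ "{}"]) auto
    next
      case False
      then obtain x y where xy: "x \<ge> 0" "y \<ge> 0" "poly D x < 0" "poly D y > 0"
        by (auto simp: not_le)
      have "\<exists>z>0. poly D z = 0"
        using xy poly_IVT_pos[of x y D] poly_IVT_neg[of y x D]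
        by (cases x y rule: linorder_cases) (auto intro: le_less_trans)
      then obtain z where z: "z > 0" "poly D z = 0" by blast
      then obtain q where q: "D = [:- z, 1:] * q"
        by (metis dvdE poly_eq_0_iff_dvd)
      have "q \<noteq> 0" using less.prems q by auto
      then have "degree q < degree D" unfolding q by (subst degree_mult_eq) auto
      then obtain E T where ET: "finite T" "T \<subseteq> {0<..}" "q = E * (\<Prod>t\<in>T. [:- t, 1:])"
        "(\<forall>x\<ge>0. 0 \<le> poly E x) \<or> (\<forall>x\<ge>0. poly E x \<le> 0)"
        using less.hyps \<open>q \<noteq> 0\<close> by blast
      show ?thesis
      proof (cases "z \<in> T")
        case True
        have "D = ([:- z, 1:]\<^sup>2 * E) * (\<Prod>t\<in>T - {z}. [:- t, 1:])"
          unfolding q ET(3) using True ET(1)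
          by (simp add: prod.remove[of T z] power2_eq_square ac_simps del: mult_pCons_left mult_pCons_right)
        moreover have "(\<forall>x\<ge>0. 0 \<le> poly ([:- z, 1:]\<^sup>2 * E) x) \<or> (\<forall>x\<ge>0. poly ([:- z, 1:]\<^sup>2 * E) x \<le> 0)"
        proof -
          have "poly ([:- z, 1:]\<^sup>2 * E) x = (x - z)\<^sup>2 * poly E x" for x
            by (simp only: poly_mult poly_power) simp
          with ET(4) show ?thesis by (auto simp only: mult_nonneg_nonpos zero_le_power2 zero_le_mult_iff mult_le_0_iff)
        qed
        ultimately show ?thesis
          using ET by (intro exI[of _ "[:- z, 1:]\<^sup>2 * E"] exI[of _ "T - {z}"]) auto
      next
        case False
        then have "D = E * (\<Prod>t\<in>insert z T. [:- t, 1:])"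
          using ET(1) by (simp add: q ET(3) ac_simps del: mult_pCons_left mult_pCons_right)
        then show ?thesis
          using ET z by (intro exI[of _ E] exI[of _ "insert z T"]) auto
      qed
    qed
  qed
  then show ?thesis using that by blast
qed

text \<open>The equations \<open>A0 C0 + x A1 C1 = P E\<close> and
  \<open>B0 C0 + x B1 C1 = Q E\<close> have determinant \<open>x D = x E M\<close>, where
  \<open>M\<close> is the product over the sign changes. Cramer's rule gives
  \<open>C0 = (P B1 - Q A1) / M\<close> and \<open>C1 = (A0 Q - B0 P) / (x M)\<close>, and the
  conditions on \<open>P\<close> and \<open>Q\<close> make both divisions exact. The last conclusion
  is what permits a later perturbation of the numerator.\<close>

lemma common_multiplier_nonneg:
  fixes A0 A1 B0 B1 :: "real poly"
  assumes deg: "degree A0 \<le> Suc n" "degree A1 \<le> n" "degree B0 \<le> Suc n" "degree B1 \<le> n"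
    and lead: "coeff A0 (Suc n) = coeff B0 (Suc n)"
    and inphase: "\<And>t. 0 \<le> t \<Longrightarrow> t = 0 \<or> poly (A0 * B1 - A1 * B0) t = 0 \<Longrightarrow>
        0 < poly A0 t * poly B0 t + t * (poly A1 t * poly B1 t)"
  obtains C0 C1 where "degree C0 \<le> Suc n" "degree C1 \<le> n"
    and "\<forall>t\<ge>0. 0 \<le> poly A0 t * poly C0 t + t * (poly A1 t * poly C1 t)"
    and "\<forall>t\<ge>0. 0 \<le> poly B0 t * poly C0 t + t * (poly B1 t * poly C1 t)"
    and "\<forall>t\<ge>0. poly B0 t * poly C0 t + t * (poly B1 t * poly C1 t) = 0 \<longrightarrow>
        0 < poly A0 t * poly B0 t + t * (poly A1 t * poly B1 t)"
proof (cases "A0 * B1 - A1 * B0 = 0")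
  case True
  \<comment> \<open>With \<open>D = 0\<close> the hypothesis \<open>inphase\<close> applies at every
    \<open>t >= 0\<close>, so the zero multiplier already satisfies the last conclusion.\<close>
  then show ?thesis
    using that[of 0 0] inphase by simp
next
  case False
  define D where "D = A0 * B1 - A1 * B0"
  obtain E T where T: "finite T" "T \<subseteq> {0<..}" and D: "D = E * (\<Prod>t\<in>T. [:- t, 1:])"
    and E: "(\<forall>x\<ge>0. 0 \<le> poly E x) \<or> (\<forall>x\<ge>0. poly E x \<le> 0)"
    using sign_change_factorization False unfolding D_def by metis
  define M where "M = (\<Prod>t\<in>T. [:- t, 1::real:])"
  have M0: "M \<noteq> 0" and degM: "degree M = card T"
    using T by (auto simp: M_def degree_prod_linear)
  have DT: "poly D t = 0" if "t \<in> T" for t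
    using that T by (auto simp: D poly_prod)
  \<comment> \<open>At \<open>t = omega^2\<close>, \<open>G\<close> is the real part of conj(a) b
    and \<open>N\<close> is the squared modulus of a; \<open>\<kappa>\<close> is therefore the real
    part of b/a, and equals b/a where the two are in phase.\<close>
  define G where "G = (\<lambda>t. poly A0 t * poly B0 t + t * (poly A1 t * poly B1 t))"
  define N where "N = (\<lambda>t. (poly A0 t)\<^sup>2 + t * (poly A1 t)\<^sup>2)"
  define \<kappa> where "\<kappa> = (\<lambda>t. G t / N t)"
  have Gpos: "G t > 0" if "t \<ge> 0" "t = 0 \<or> poly D t = 0" for t
    using inphase[of t] that by (auto simp: G_def D_def)
  have Npos: "N t > 0" if "t \<in> insert 0 T" for t
  proof -
    have "t \<ge> 0" "G t > 0" using that T DT by (auto intro!: Gpos)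
    then have "poly A0 t \<noteq> 0 \<or> t \<noteq> 0 \<and> poly A1 t \<noteq> 0" by (auto simp: G_def)
    with \<open>t \<ge> 0\<close> show ?thesis by (auto simp: N_def intro: add_pos_nonneg add_nonneg_pos)
  qed
  have \<kappa>pos: "\<kappa> t > 0" if "t \<in> insert 0 T" for t
    using that T DT Npos[OF that] unfolding \<kappa>_def by (intro divide_pos_pos Gpos) auto
  have B0: "poly B0 t = \<kappa> t * poly A0 t" if "t \<in> insert 0 T" for t
  proof -
    have "poly B0 t * N t - G t * poly A0 t = - t * poly A1 t * poly D t"
      by (simp add: N_def G_def D_def power2_eq_square algebra_simps)
    also have "\<dots> = 0" using that DT by auto
    finally show ?thesis using Npos[OF that] by (simp add: \<kappa>_def field_simps)
  qed
  \<comment> \<open>Unlike for \<open>B0\<close>, the node 0 is excluded: the difference is now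
    \<open>A0 D\<close> without a factor \<open>t\<close>. Accordingly only the numerator of
    \<open>C1\<close> is divided by \<open>x\<close>.\<close>
  have B1: "poly B1 t = \<kappa> t * poly A1 t" if "t \<in> T" for t
  proof -
    have "poly B1 t * N t - G t * poly A1 t = poly A0 t * poly D t"
      by (simp add: N_def G_def D_def power2_eq_square algebra_simps)
    also have "\<dots> = 0" using that DT by auto
    finally show ?thesis using Npos[of t] that by (simp add: \<kappa>_def field_simps)
  qed
  obtain P Q where degPQ: "degree P \<le> Suc (card T)" "degree Q \<le> Suc (card T)"
    and leadPQ: "coeff P (Suc (card T)) = coeff Q (Suc (card T))"
    and PQ: "\<forall>t\<in>insert 0 T. poly Q t = \<kappa> t * poly P t"
    and nonneg: "\<forall>x\<ge>0. 0 \<le> poly P x \<and> 0 \<le> poly Q x"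
    and pos: "\<forall>x>0. x \<notin> T \<longrightarrow> 0 < poly P x \<and> 0 < poly Q x"
    by (rule interlacing_pair[OF T]) (erule \<kappa>pos, rule that)
  have "(\<Prod>t\<in>T. [:- t, 1:]) dvd P * B1 - Q * A1"
    using T PQ B1 by (intro prod_linear_dvd) auto
  then obtain C0 where C0: "P * B1 - Q * A1 = M * C0" unfolding M_def by blast
  have "(\<Prod>t\<in>insert 0 T. [:- t, 1:]) dvd A0 * Q - B0 * P"
    using T PQ B0 by (intro prod_linear_dvd) auto
  then obtain C1' where "A0 * Q - B0 * P = (\<Prod>t\<in>insert 0 T. [:- t, 1:]) * C1'" by blast
  moreover have "(\<Prod>t\<in>insert 0 T. [:- t, 1:]) = [:0, 1:] * M"
    using T by (subst prod.insert) (auto simp: M_def)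
  ultimately obtain C1 where C1: "A0 * Q - B0 * P = [:0, 1:] * M * C1" by metis
  have "M * (A0 * C0 + [:0, 1:] * A1 * C1) = A0 * (M * C0) + A1 * ([:0, 1:] * M * C1)"
    by (simp add: algebra_simps del: mult_pCons_left mult_pCons_right)
  also have "\<dots> = P * D"
    unfolding C0[symmetric] C1[symmetric] by (simp add: D_def algebra_simps)
  also have "\<dots> = M * (P * E)"
    by (simp add: D M_def ac_simps)
  finally have F: "A0 * C0 + [:0, 1:] * A1 * C1 = P * E" using M0 by simp
  have "M * (B0 * C0 + [:0, 1:] * B1 * C1) = B0 * (M * C0) + B1 * ([:0, 1:] * M * C1)"
    by (simp add: algebra_simps del: mult_pCons_left mult_pCons_right)
  also have "\<dots> = Q * D"
    unfolding C0[symmetric] C1[symmetric] by (simp add: D_def algebra_simps)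
  also have "\<dots> = M * (Q * E)"
    by (simp add: D M_def ac_simps)
  finally have H: "B0 * C0 + [:0, 1:] * B1 * C1 = Q * E" using M0 by simp
  have F': "poly A0 t * poly C0 t + t * (poly A1 t * poly C1 t) = poly P t * poly E t"
    and H': "poly B0 t * poly C0 t + t * (poly B1 t * poly C1 t) = poly Q t * poly E t" for t
    using arg_cong[OF F, of "\<lambda>p. poly p t"] arg_cong[OF H, of "\<lambda>p. poly p t"] by simp_all
  have dC0: "degree C0 \<le> Suc n"
  proof (cases "C0 = 0")
    case False
    have "degree (P * B1 - Q * A1) \<le> Suc (card T) + n"
      using degree_mult_le[of P B1] degree_mult_le[of Q A1] deg degPQ
      by (intro degree_diff_le) linarith+
    with False M0 show ?thesis by (simp add: C0 degree_mult_eq degM)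
  qed simp
  \<comment> \<open>Counting degrees alone gives the bound \<open>Suc n\<close>. The equal leading
    coefficients of \<open>A0\<close>, \<open>B0\<close> and of \<open>P\<close>, \<open>Q\<close>
    cancel the top coefficient of \<open>R\<close> and lower the bound by one.\<close>
  have dC1: "degree C1 \<le> n"
  proof (cases "C1 = 0")
    case False
    define R where "R = A0 * Q - B0 * P"
    have "degree R \<le> Suc n + Suc (card T)"
      using degree_mult_le[of A0 Q] degree_mult_le[of B0 P] deg degPQ unfolding R_def
      by (intro degree_diff_le) linarith+
    moreover have "coeff R (Suc n + Suc (card T)) = 0"
      unfolding R_def coeff_diff
      using coeff_mult_top[OF deg(1) degPQ(2)] coeff_mult_top[OF deg(3) degPQ(1)] lead leadPQ by simp
    moreover have "degree R = Suc (card T + degree C1)"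
      using False M0 by (simp add: R_def C1 degree_mult_eq degM del: mult_pCons_left)
    moreover have "R \<noteq> 0" using False M0 by (simp add: R_def C1 del: mult_pCons_left)
    ultimately show ?thesis
      by (metis add_Suc add_Suc_right add.commute add_le_cancel_left le_SucE leading_coeff_0_iff Suc_le_mono)
  qed simp
  have G0: "0 < G t" if "0 \<le> t" "poly Q t * poly E t = 0" for t
  proof (rule Gpos[OF that(1)])
    have "t = 0 \<or> t \<in> T \<or> poly E t = 0"
    proof (cases "t = 0 \<or> t \<in> T")
      case False
      then have "0 < poly Q t" using that(1) pos by auto
      with that(2) show ?thesis by simp
    qed auto
    then show "t = 0 \<or> poly D t = 0" using DT by (auto simp: D)
  qed
  from E show ?thesis
  proof
    assume "\<forall>x\<ge>0. 0 \<le> poly E x"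
    then show ?thesis
      using dC0 dC1 nonneg G0 by (intro that[of C0 C1]) (auto simp: F' H' G_def)
  next
    assume "\<forall>x\<ge>0. poly E x \<le> 0"
    moreover have "poly A0 t * poly (- C0) t + t * (poly A1 t * poly (- C1) t) = - (poly P t * poly E t)"
      "poly B0 t * poly (- C0) t + t * (poly B1 t * poly (- C1) t) = - (poly Q t * poly E t)" for t
      using F'[of t] H'[of t] by (simp_all only: poly_minus mult_minus_right)
    ultimately show ?thesis
      using dC0 dC1 nonneg G0
      by (intro that[of "- C0" "- C1"]) (auto simp: G_def mult_nonneg_nonpos simp del: poly_minus)
  qed
qed

section \<open>Polynomials on the imaginary axis\<close>

text \<open>The even and odd parts are written as polynomials in \<open>- s^2\<close>, not
  \<open>s^2\<close>, so that at s = i omega their argument is omega^2, a point of the half-line on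
  which positivity is studied.\<close>

lemma even_odd_decomposition:
  fixes p :: "'a::comm_ring_1 poly"
  obtains p0 p1 where "\<forall>k. coeff p0 k = (- 1) ^ k * coeff p (2 * k)"
    and "\<forall>k. coeff p1 k = (- 1) ^ k * coeff p (Suc (2 * k))"
    and "p = pcompose p0 [:0, 0, - 1:] + [:0, 1:] * pcompose p1 [:0, 0, - 1:]"
proof -
  have "\<exists>p0 p1. (\<forall>k. coeff p0 k = (- 1) ^ k * coeff p (2 * k)) \<and>
      (\<forall>k. coeff p1 k = (- 1) ^ k * coeff p (Suc (2 * k))) \<and>
      p = pcompose p0 [:0, 0, - 1:] + [:0, 1:] * pcompose p1 [:0, 0, - 1:]"
  proof (induction p)
    case 0
    show ?case by (intro exI[of _ 0]) simp
  next
    case (pCons a p)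
    then obtain p0 p1 where IH: "\<And>k. coeff p0 k = (- 1) ^ k * coeff p (2 * k)"
      "\<And>k. coeff p1 k = (- 1) ^ k * coeff p (Suc (2 * k))"
      "p = pcompose p0 [:0, 0, - 1:] + [:0, 1:] * pcompose p1 [:0, 0, - 1:]" by blast
    have "pCons a p = [:a:] + [:0, 1:] * p" by simp
    also have "\<dots> = pcompose (pCons a (- p1)) [:0, 0, - 1:] + [:0, 1:] * pcompose p0 [:0, 0, - 1:]"
      by (subst IH(3)) (simp add: pcompose_pCons pcompose_uminus algebra_simps)
    finally have "pCons a p = \<dots>" .
    moreover have "coeff (pCons a (- p1)) k = (- 1) ^ k * coeff (pCons a p) (2 * k)" for k
      by (cases k) (auto simp: IH(2))
    moreover have "coeff p0 k = (- 1) ^ k * coeff (pCons a p) (Suc (2 * k))" for k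
      by (simp add: IH(1))
    ultimately show ?case by blast
  qed
  then show ?thesis using that by blast
qed

lemma cpoly_add: "cpoly (p + q) s = cpoly p s + cpoly q s"
proof -
  have "map_poly complex_of_real (p + q) = map_poly complex_of_real p + map_poly complex_of_real q"
    by (rule poly_eqI) (simp add: coeff_map_poly)
  then show ?thesis by simp
qed

lemma cpoly_smult: "cpoly (smult c p) s = of_real c * cpoly p s"
proof -
  have "map_poly complex_of_real (smult c p) = smult (of_real c) (map_poly complex_of_real p)"
    by (rule poly_eqI) (simp add: coeff_map_poly)
  then show ?thesis by simp
qed

lemma cpoly_even_odd:
  "cpoly (pcompose p0 [:0, 0, - 1:] + [:0, 1:] * pcompose p1 [:0, 0, - 1:]) (\<i> * of_real \<omega>) =
     Complex (poly p0 (\<omega>\<^sup>2)) (\<omega> * poly p1 (\<omega>\<^sup>2))"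
proof -
  have *: "cpoly (pcompose p [:0, 0, - 1:]) (\<i> * of_real \<omega>) = of_real (poly p (\<omega>\<^sup>2))" for p
  proof (induction p)
    case (pCons a p)
    have "pcompose (pCons a p) [:0, 0, - 1:] = pCons a (pCons 0 (- pcompose p [:0, 0, - 1:]))"
      by (simp add: pcompose_pCons)
    moreover have "cpoly (- pcompose p [:0, 0, - 1:]) (\<i> * of_real \<omega>) = - of_real (poly p (\<omega>\<^sup>2))"
      using cpoly_smult[of "- 1" "pcompose p [:0, 0, - 1:]" "\<i> * of_real \<omega>"] pCons.IH by simp
    ultimately show ?case
      by (simp add: map_poly_pCons power2_eq_square algebra_simps)
  qed simp
  have "cpoly ([:0, 1:] * pcompose p1 [:0, 0, - 1:]) (\<i> * of_real \<omega>) =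
      \<i> * of_real \<omega> * of_real (poly p1 (\<omega>\<^sup>2))"
    using *[of p1] by (simp add: map_poly_pCons)
  then show ?thesis unfolding cpoly_add * by (simp add: complex_eq_iff)
qed

lemma Re_divide_pos_iff:
  assumes "w \<noteq> 0"
  shows "0 < Re (z / w) \<longleftrightarrow> 0 < Re z * Re w + Im z * Im w"
proof -
  have "0 < (Re w)\<^sup>2 + (Im w)\<^sup>2"
    using assms by (metis complex_neq_0)
  then show ?thesis by (simp add: Re_divide zero_less_divide_iff)
qed

lemma hurwitz_cpoly_nz: "p \<in> hurwitz n \<Longrightarrow> 0 \<le> Re s \<Longrightarrow> cpoly p s \<noteq> 0"
  by (force simp: hurwitz_def)

text \<open>If b/a were real and nonpositive at a point of the imaginary axis, 0 would lie on the
  segment between the two values, and some member of the family would vanish there.\<close>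

lemma hurwitz_segment_in_phase:
  assumes seg: "\<And>l. 0 \<le> l \<Longrightarrow> l \<le> 1 \<Longrightarrow> smult l b + smult (1 - l) a \<in> hurwitz n"
    and s: "Re s = 0" and im: "Im (cnj (cpoly a s) * cpoly b s) = 0"
  shows "0 < Re (cnj (cpoly a s) * cpoly b s)"
proof (rule ccontr)
  define z w where "z = cpoly a s" and "w = cpoly b s"
  define \<rho> where "\<rho> = - Re (cnj z * w)"
  assume "\<not> 0 < Re (cnj (cpoly a s) * cpoly b s)"
  then have \<rho>: "\<rho> \<ge> 0" by (simp add: \<rho>_def z_def w_def)
  have zw: "cnj z * w = - of_real \<rho>"
    using im by (simp add: \<rho>_def complex_eq_iff z_def w_def)
  have z: "z \<noteq> 0"
    using hurwitz_cpoly_nz[OF seg[of 0], of s] s by (simp add: z_def)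
  define N where "N = (cmod z)\<^sup>2"
  have N: "N > 0" "cnj z * z = of_real N"
    using z complex_norm_square[of z] by (simp_all add: N_def mult.commute)
  \<comment> \<open>This weight solves \<open>l * (- \<rho>) + (1 - l) * N = 0\<close>, the equation
    for a zero after multiplication by \<open>cnj z\<close>.\<close>
  define l where "l = N / (N + \<rho>)"
  have l: "0 \<le> l" "l \<le> 1" "(1 - l) * N = l * \<rho>"
    using N \<rho> by (auto simp: l_def field_simps)
  have "cnj z * (of_real l * w + of_real (1 - l) * z) = of_real l * (cnj z * w) + of_real (1 - l) * (cnj z * z)"
    by (simp add: algebra_simps)
  also have "\<dots> = of_real ((1 - l) * N - l * \<rho>)"
    unfolding zw N by simp
  also have "\<dots> = 0" using l by simp
  finally have "of_real l * w + of_real (1 - l) * z = 0"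
    using z by simp
  then have "cpoly (smult l b + smult (1 - l) a) s = 0"
    by (simp add: cpoly_add cpoly_smult z_def w_def)
  with hurwitz_cpoly_nz[OF seg[OF l(1,2)], of s] s show False by simp
qed

text \<open>The points with \<open>G <= 0\<close> form a compact set \<open>K\<close>, since
  \<open>G\<close> is positive far out; on \<open>K\<close> the polynomial \<open>H\<close> has no
  zeros and hence a positive minimum, while off \<open>K\<close> every positive \<open>e\<close>
  works. Having all \<open>e\<close> up to the bound leaves room to avoid a bad value later.\<close>

lemma exists_perturbation_pos:
  fixes H G :: "real poly"
  assumes nonneg: "\<And>t. 0 \<le> t \<Longrightarrow> 0 \<le> poly H t"
    and zeros: "\<And>t. 0 \<le> t \<Longrightarrow> poly H t = 0 \<Longrightarrow> 0 < poly G t"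
    and lead: "lead_coeff G > 0"
  obtains \<epsilon> where "\<epsilon> > 0" "\<forall>e t. 0 < e \<longrightarrow> e \<le> \<epsilon> \<longrightarrow> 0 \<le> t \<longrightarrow> 0 < poly H t + e * poly G t"
proof -
  obtain R where R: "\<forall>x\<ge>R. lead_coeff G \<le> poly G x"
    using poly_pinfty_gt_lc[OF lead] by blast
  define K where "K = {0..R} \<inter> {t. poly G t \<le> 0}"
  have K: "compact K"
    unfolding K_def by (intro compact_Int_closed closed_Collect_le continuous_intros) auto
  have outside: "0 < poly G t" if "0 \<le> t" "t \<notin> K" for t
  proof (cases "t \<le> R")
    case False
    with R have "lead_coeff G \<le> poly G t" by simp
    with lead show ?thesis by simp
  qed (use that in \<open>simp add: K_def\<close>)
  have cont: "continuous_on K (poly p)" for p :: "real poly"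
    by (intro continuous_intros)
  have GK: "poly G t \<le> 0" "0 \<le> t" if "t \<in> K" for t
    using that by (auto simp: K_def)
  show ?thesis
  proof (cases "K = {}")
    case True
    show ?thesis
    proof (rule that[of 1], simp, intro allI impI)
      fix e t :: real assume "0 < e" "0 \<le> t"
      then show "0 < poly H t + e * poly G t"
        using outside[of t] nonneg[of t] True by (simp add: add_nonneg_pos)
    qed
  next
    case False
    obtain t0 where t0: "t0 \<in> K" "\<forall>t\<in>K. poly H t0 \<le> poly H t"
      using continuous_attains_inf[OF K False cont[of H]] by blast
    obtain t1 where t1: "t1 \<in> K" "\<forall>t\<in>K. poly G t1 \<le> poly G t"
      using continuous_attains_inf[OF K False cont[of G]] by blast
    define m B where "m = poly H t0" and "B = - poly G t1"
    have m: "m > 0"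
      using GK[OF t0(1)] nonneg[of t0] zeros[of t0] by (force simp: m_def)
    have B: "B \<ge> 0" using GK[OF t1(1)] by (simp add: B_def)
    show ?thesis
    \<comment> \<open>The summand 1 makes the denominator positive even for \<open>B = 0\<close> and
      gives the strict inequality \<open>e * B < m\<close>.\<close>
    proof (rule that[of "m / (B + 1)"], use m B in simp, intro allI impI)
      fix e t :: real assume e: "0 < e" "e \<le> m / (B + 1)" and t: "0 \<le> t"
      show "0 < poly H t + e * poly G t"
      proof (cases "t \<in> K")
        case True
        have "e * B < m"
        proof -
          have "e * (B + 1) \<le> m" using e B by (simp add: field_simps)
          with e show ?thesis by (simp add: algebra_simps)
        qed
        moreover have "e * (- B) \<le> e * poly G t"
          using bspec[OF t1(2) True] e by (intro mult_left_mono) (auto simp: B_def)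
        moreover have "m \<le> poly H t" using bspec[OF t0(2) True] by (simp add: m_def)
        ultimately show ?thesis by simp
      next
        case False
        then show ?thesis using outside[OF t] nonneg[OF t] e by (simp add: add_nonneg_pos)
      qed
    qed
  qed
qed

lemma ratfun_tendsto_at_infinity:
  assumes "degree p = degree q"
  shows "((ratfun p q) \<longlongrightarrow> of_real (lead_coeff p / lead_coeff q)) at_infinity"
proof (cases "q = 0")
  case True
  \<comment> \<open>Both sides are quotients by zero, which have the value 0.\<close>
  then show ?thesis by (simp add: ratfun_def[abs_def])
next
  case False
  have lead: "((\<lambda>s. cpoly r s / s ^ degree r) \<longlongrightarrow> of_real (lead_coeff r)) at_infinity" for r
    using poly_divide_tendsto_aux[of "map_poly complex_of_real r"]
    by (simp add: coeff_map_poly degree_map_poly)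
  have "((\<lambda>s. (cpoly p s / s ^ degree p) / (cpoly q s / s ^ degree q)) \<longlongrightarrow>
      of_real (lead_coeff p) / of_real (lead_coeff q)) at_infinity"
    using False by (intro tendsto_divide lead) simp
  moreover have "\<forall>\<^sub>F s in at_infinity.
      (cpoly p s / s ^ degree p) / (cpoly q s / s ^ degree q) = ratfun p q s"
    by (rule eventually_at_infinityI[of 1]) (use assms in \<open>auto simp: ratfun_def\<close>)
  ultimately show ?thesis by (simp add: tendsto_cong)
qed

section \<open>Strict positive realness and stable segments\<close>

lemma strictly_positive_real_Re_pos:
  assumes spr: "strictly_positive_real c a" and z0: "0 \<le> Re z0"
  shows "0 < Re (ratfun c a z0)"
proof -
  define f where "f = ratfun c a"
  have deg: "degree c = degree a" and a: "a \<in> hurwitz (degree a)"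
    and axis: "\<And>\<omega>. 0 < Re (f (\<i> * of_real \<omega>))"
    using spr by (auto simp: strictly_positive_real_def f_def)
  define l where "l = lead_coeff c / lead_coeff a"
  have lim: "(f \<longlongrightarrow> of_real l) at_infinity"
    unfolding f_def l_def by (rule ratfun_tendsto_at_infinity[OF deg])
  have "l \<ge> 0"
  proof -
    have "filterlim (\<lambda>\<omega>. \<i> * complex_of_real \<omega>) at_infinity at_top"
      unfolding filterlim_at_infinity_conv_norm_at_top by (simp add: norm_mult filterlim_abs_real)
    from filterlim_compose[OF lim this]
    have "((\<lambda>\<omega>. Re (f (\<i> * of_real \<omega>))) \<longlongrightarrow> Re (of_real l)) at_top"
      by (rule tendsto_Re)
    then have "0 \<le> Re (complex_of_real l)"
      by (rule tendsto_lowerbound) (simp_all add: less_imp_le[OF axis])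
    then show ?thesis by simp
  qed
  \<comment> \<open>A limit of positive values could still be 0. But \<open>l = 0\<close> would
    force \<open>c = 0\<close>, and then \<open>f\<close> would vanish at 0, which lies on the
    axis.\<close>
  moreover have "l \<noteq> 0"
    using axis[of 0] hurwitz_cpoly_nz[OF a, of 0] by (auto simp: l_def f_def ratfun_def)
  ultimately have "l > 0" by simp
  have "((\<lambda>s. Re (f s)) \<longlongrightarrow> l) at_infinity"
    using tendsto_Re[OF lim] by simp
  then have "\<forall>\<^sub>F s in at_infinity. 0 < Re (f s)"
    using \<open>l > 0\<close> by (rule order_tendstoD)
  then obtain R where R: "\<And>s. R \<le> norm s \<Longrightarrow> 0 < Re (f s)"
    by (auto simp: eventually_at_infinity)
  \<comment> \<open>The radius is chosen so that the half disc contains \<open>z0\<close> and its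
    arc lies where the limit at infinity already makes the real part positive.\<close>
  define r where "r = max R (norm z0)"
  define S where "S = {s. 0 \<le> Re s} \<inter> cball 0 r"
  have "closed S" "bounded S"
    unfolding S_def by (auto intro: closed_halfspace_Re_ge closed_Int bounded_Int)
  then have S: "compact S" by (simp add: compact_eq_bounded_closed)
  have hol: "f analytic_on {s. 0 \<le> Re s}"
    unfolding f_def by (rule strictly_positive_real_analytic[OF spr])
  then have cont: "continuous_on S f"
    by (rule continuous_on_subset[OF holomorphic_on_imp_continuous_on[OF analytic_imp_holomorphic]])
      (auto simp: S_def)
  have fr: "frontier S \<subseteq> S" "compact (frontier S)"
    using \<open>closed S\<close> S by (simp_all add: frontier_subset_closed compact_frontier)
  have pos: "0 < Re (f s)" if "s \<in> frontier S" for s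
  proof -
    have "s \<in> S" using that fr by auto
    have "{s. 0 < Re s} \<inter> ball 0 r \<subseteq> interior S"
      by (rule interior_maximal) (auto simp: S_def intro: open_halfspace_Re_gt open_Int)
    moreover have "s \<notin> interior S" using that by (simp add: frontier_def)
    ultimately have "Re s = 0 \<or> norm s = r"
      using \<open>s \<in> S\<close> by (force simp: S_def)
    then show ?thesis
    proof
      assume "Re s = 0"
      then have "s = \<i> * of_real (Im s)" by (simp add: complex_eq_iff)
      with axis[of "Im s"] show ?thesis by simp
    next
      assume "norm s = r"
      then show ?thesis by (intro R) (simp add: r_def)
    qed
  qed
  \<comment> \<open>Compactness turns positivity on the frontier into a uniform bound, because the
    maximum principle, applied to \<open>- f\<close>, only transfers a non-strict
    inequality.\<close>
  obtain m where m: "m > 0" "\<And>s. s \<in> frontier S \<Longrightarrow> m \<le> Re (f s)"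
  proof (cases "frontier S = {}")
    case True
    then show ?thesis using that[of 1] by auto
  next
    case False
    have "continuous_on (frontier S) (\<lambda>s. Re (f s))"
      using continuous_on_subset[OF cont fr(1)] by (intro continuous_intros)
    from continuous_attains_inf[OF fr(2) False this] pos that show ?thesis by blast
  qed
  have "Re (- f z0) \<le> - m"
  proof (rule maximum_real_frontier[where f = "\<lambda>s. - f s" and S = S])
    show "(\<lambda>s. - f s) holomorphic_on interior S"
      using hol interior_subset[of S]
      by (intro holomorphic_intros) (auto simp: S_def intro: analytic_imp_holomorphic analytic_on_subset)
    show "continuous_on (closure S) (\<lambda>s. - f s)"
      using cont \<open>closed S\<close> by (simp add: closure_closed continuous_on_minus)
    show "z0 \<in> S" using z0 by (simp add: S_def r_def)
  qed (use m \<open>bounded S\<close> in auto)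
  with m show ?thesis by (simp add: f_def)
qed

text \<open>For fixed s in the closed right half-plane, a(s) and b(s) lie in the open half-plane of
  all z with Re(conj(c(s)) z) > 0. It is convex and does not contain 0, so no convex combination
  vanishes at s. Equal leading coefficients keep the degree constant along the segment.\<close>

theorem hurwitz_segment_if_strictly_positive_real:
  assumes ca: "strictly_positive_real c a" and cb: "strictly_positive_real c b"
    and lead: "lead_coeff a = lead_coeff b" and l: "0 \<le> l" "l \<le> 1"
  shows "smult l b + smult (1 - l) a \<in> hurwitz (degree a)"
proof -
  define d where "d = smult l b + smult (1 - l) a"
  have deg: "degree b = degree a" and a: "a \<in> hurwitz (degree a)" and b: "b \<in> hurwitz (degree b)"
    using ca cb by (auto simp: strictly_positive_real_def)
  have "a \<noteq> 0" using hurwitz_cpoly_nz[OF a, of 0] by auto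
  have "degree d \<le> degree a"
    unfolding d_def using deg by (intro degree_add_le order.trans[OF degree_smult_le]) auto
  moreover have "coeff d (degree a) = lead_coeff a"
    using lead deg by (simp add: d_def algebra_simps)
  ultimately have "degree d = degree a"
    using \<open>a \<noteq> 0\<close> by (metis le_antisym le_degree leading_coeff_0_iff)
  moreover have "Re s < 0" if "cpoly d s = 0" for s
  proof (rule ccontr)
    assume "\<not> Re s < 0"
    then have s: "0 \<le> Re s" by simp
    define x y w where "x = cpoly a s" and "y = cpoly b s" and "w = cpoly c s"
    have nz: "x \<noteq> 0" "y \<noteq> 0"
      using hurwitz_cpoly_nz[OF a s] hurwitz_cpoly_nz[OF b s] by (auto simp: x_def y_def)
    have wx: "0 < Re w * Re x + Im w * Im x" and wy: "0 < Re w * Re y + Im w * Im y"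
      using strictly_positive_real_Re_pos[OF ca s] strictly_positive_real_Re_pos[OF cb s]
        Re_divide_pos_iff[OF nz(1)] Re_divide_pos_iff[OF nz(2)]
      by (auto simp: ratfun_def x_def y_def w_def)
    have 0: "of_real l * y + of_real (1 - l) * x = 0"
      using that by (simp add: d_def cpoly_add cpoly_smult x_def y_def)
    then have "l * Re y + (1 - l) * Re x = 0" "l * Im y + (1 - l) * Im x = 0"
      by (simp_all add: complex_eq_iff)
    then have "Re w * (l * Re y + (1 - l) * Re x) + Im w * (l * Im y + (1 - l) * Im x) = 0" by simp
    moreover have "Re w * (l * Re y + (1 - l) * Re x) + Im w * (l * Im y + (1 - l) * Im x) =
        l * (Re w * Re y + Im w * Im y) + (1 - l) * (Re w * Re x + Im w * Im x)"
      by (simp add: algebra_simps)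
    moreover have "0 < l * (Re w * Re y + Im w * Im y) + (1 - l) * (Re w * Re x + Im w * Im x)"
    proof (cases "l = 0")
      case False
      then show ?thesis using l wx wy by (intro add_pos_nonneg) auto
    qed (use wx in simp)
    ultimately show False by simp
  qed
  ultimately show ?thesis by (simp add: hurwitz_def d_def)
qed

section \<open>Sufficiency: assembling the common numerator\<close>

theorem exists_strictly_positive_real_if_hurwitz_segment:
  assumes deg: "degree a = 2 * Suc n" "degree b = 2 * Suc n"
    and lead: "lead_coeff a = lead_coeff b"
    and seg: "\<And>l. 0 \<le> l \<Longrightarrow> l \<le> 1 \<Longrightarrow> smult l b + smult (1 - l) a \<in> hurwitz (2 * Suc n)"
  shows "\<exists>c. strictly_positive_real c a \<and> strictly_positive_real c b"
proof -
  define m where "m = 2 * Suc n"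
  have a: "a \<in> hurwitz m" and b: "b \<in> hurwitz m"
    using seg[of 0] seg[of 1] by (auto simp: m_def)
  have "a \<noteq> 0" using deg by auto
  then have a0: "lead_coeff a \<noteq> 0" by (rule leading_coeff_neq_0)
  obtain A0 A1 where A: "\<forall>k. coeff A0 k = (- 1) ^ k * coeff a (2 * k)"
      "\<forall>k. coeff A1 k = (- 1) ^ k * coeff a (Suc (2 * k))"
      "a = pcompose A0 [:0, 0, - 1:] + [:0, 1:] * pcompose A1 [:0, 0, - 1:]"
    by (rule even_odd_decomposition[of a]) (rule that)
  obtain B0 B1 where B: "\<forall>k. coeff B0 k = (- 1) ^ k * coeff b (2 * k)"
      "\<forall>k. coeff B1 k = (- 1) ^ k * coeff b (Suc (2 * k))"
      "b = pcompose B0 [:0, 0, - 1:] + [:0, 1:] * pcompose B1 [:0, 0, - 1:]"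
    by (rule even_odd_decomposition[of b]) (rule that)
  have degAB: "degree A0 \<le> Suc n" "degree A1 \<le> n" "degree B0 \<le> Suc n" "degree B1 \<le> n"
    using deg by (auto intro!: degree_le simp: A(1,2) B(1,2) coeff_eq_0)
  have leadAB: "coeff A0 (Suc n) = coeff B0 (Suc n)" and leadA: "coeff A0 (Suc n) \<noteq> 0"
    using lead deg a0 by (auto simp: A(1) B(1))
  have evala: "cpoly a (\<i> * of_real \<omega>) = Complex (poly A0 (\<omega>\<^sup>2)) (\<omega> * poly A1 (\<omega>\<^sup>2))" for \<omega>
    by (subst A(3)) (rule cpoly_even_odd)
  have evalb: "cpoly b (\<i> * of_real \<omega>) = Complex (poly B0 (\<omega>\<^sup>2)) (\<omega> * poly B1 (\<omega>\<^sup>2))" for \<omega>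
    by (subst B(3)) (rule cpoly_even_odd)
  have inphase: "0 < poly A0 t * poly B0 t + t * (poly A1 t * poly B1 t)"
    if "0 \<le> t" "t = 0 \<or> poly (A0 * B1 - A1 * B0) t = 0" for t
  proof -
    define \<omega> where "\<omega> = sqrt t"
    have t: "\<omega>\<^sup>2 = t" using that(1) by (simp add: \<omega>_def)
    let ?s = "\<i> * complex_of_real \<omega>"
    \<comment> \<open>The imaginary part is omega times \<open>D\<close> at omega^2, so the factor
      omega accounts for the case \<open>t = 0\<close> of the hypothesis.\<close>
    have "Im (cnj (cpoly a ?s) * cpoly b ?s) = \<omega> * poly (A0 * B1 - A1 * B0) t"
      unfolding evala evalb t by (simp add: algebra_simps)
    also have "\<dots> = 0" using that by (auto simp: \<omega>_def)
    finally have "0 < Re (cnj (cpoly a ?s) * cpoly b ?s)"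
      by (intro hurwitz_segment_in_phase[OF seg]) auto
    also have "\<dots> = poly A0 t * poly B0 t + \<omega>\<^sup>2 * (poly A1 t * poly B1 t)"
      unfolding evala evalb t[symmetric] by (simp add: power2_eq_square)
    finally show ?thesis by (simp add: t)
  qed
  obtain C0 C1 where degC: "degree C0 \<le> Suc n" "degree C1 \<le> n"
    and F: "\<forall>t\<ge>0. 0 \<le> poly A0 t * poly C0 t + t * (poly A1 t * poly C1 t)"
    and H: "\<forall>t\<ge>0. 0 \<le> poly B0 t * poly C0 t + t * (poly B1 t * poly C1 t)"
    and H0: "\<forall>t\<ge>0. poly B0 t * poly C0 t + t * (poly B1 t * poly C1 t) = 0 \<longrightarrow>
        0 < poly A0 t * poly B0 t + t * (poly A1 t * poly B1 t)"
    by (rule common_multiplier_nonneg[OF degAB leadAB]) (erule (1) inphase, rule that)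
  define G where "G = A0 * B0 + pCons 0 (A1 * B1)"
  \<comment> \<open>As a polynomial in \<open>t\<close>, \<open>G\<close> again has degree
    \<open>m\<close>: the product \<open>A0 * B0\<close> dominates, and its top coefficient is a
    nonzero square because \<open>A0\<close> and \<open>B0\<close> agree in degree
    \<open>Suc n\<close>.\<close>
  have "degree (pCons 0 (A1 * B1)) < m"
    using degree_mult_le[of A1 B1] degAB by (simp add: m_def degree_pCons_eq_if)
  then have "coeff G m = (coeff A0 (Suc n))\<^sup>2" "degree G \<le> m"
    using coeff_mult_top[of A0 "Suc n" B0 "Suc n"] degree_mult_le[of A0 B0] degAB leadAB
    by (auto simp: G_def m_def mult_2 power2_eq_square coeff_eq_0 simp del: coeff_pCons_Suc
        intro!: degree_add_le)
  then have leadG: "lead_coeff G > 0"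
    using leadA by (metis le_antisym le_degree zero_less_power2 power_eq_0_iff)
  obtain \<epsilon> where \<epsilon>: "\<epsilon> > 0" "\<forall>e t. 0 < e \<longrightarrow> e \<le> \<epsilon> \<longrightarrow> 0 \<le> t \<longrightarrow>
      0 < poly (B0 * C0 + pCons 0 (B1 * C1)) t + e * poly G t"
  proof (rule exists_perturbation_pos[of "B0 * C0 + pCons 0 (B1 * C1)" G])
    show "0 \<le> poly (B0 * C0 + pCons 0 (B1 * C1)) t" if "0 \<le> t" for t
      using H that by simp
    show "0 < poly G t" if "0 \<le> t" "poly (B0 * C0 + pCons 0 (B1 * C1)) t = 0" for t
      using H0 that by (simp add: G_def)
  qed (use leadG in auto)
  define C where "C = pcompose C0 [:0, 0, - 1:] + [:0, 1:] * pcompose C1 [:0, 0, - 1:]"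
  have degC': "degree C \<le> m"
  proof -
    have "degree (pcompose C0 [:0, 0, - 1:]) \<le> m"
      using degC by (simp add: degree_pcompose m_def)
    moreover have "degree ([:0, 1:] * pcompose C1 [:0, 0, - 1:]) \<le> m"
      using degree_mult_le[of "[:0, 1:]" "pcompose C1 [:0, 0, - 1:]"] degC
      by (simp add: degree_pcompose m_def)
    ultimately show ?thesis unfolding C_def by (rule degree_add_le)
  qed
  (* At most one multiple of a cancels the leading coefficient of C. *)
  obtain e where e: "0 < e" "e \<le> \<epsilon>" "coeff C m + e * coeff a m \<noteq> 0"
  proof (cases "coeff C m + \<epsilon> * coeff a m = 0")
    case True
    have "\<epsilon> * coeff a m \<noteq> 0" using a0 deg \<epsilon> by (simp add: m_def)
    moreover have "coeff C m + \<epsilon> / 2 * coeff a m = - (\<epsilon> * coeff a m) / 2"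
      using True by (simp add: field_simps)
    ultimately have "coeff C m + \<epsilon> / 2 * coeff a m \<noteq> 0"
      by (metis divide_eq_0_iff neg_equal_0_iff_equal zero_neq_numeral)
    with \<epsilon> show ?thesis by (intro that[of "\<epsilon> / 2"]) auto
  next
    case False
    with \<epsilon> show ?thesis by (intro that[of \<epsilon>]) auto
  qed
  \<comment> \<open>On the axis this adds \<open>e\<close> times the squared modulus of a to the
    first expression, which was only nonnegative, and \<open>e * G\<close> to the second.\<close>
  define c where "c = C + smult e a"
  have "degree c \<le> m"
    unfolding c_def using degC' deg by (intro degree_add_le order.trans[OF degree_smult_le]) (auto simp: m_def)
  moreover have "coeff c m \<noteq> 0" using e by (simp add: c_def)
  ultimately have degc: "degree c = m" by (simp add: le_antisym le_degree)
  have evalc: "cpoly c (\<i> * of_real \<omega>) =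
      Complex (poly C0 (\<omega>\<^sup>2) + e * poly A0 (\<omega>\<^sup>2)) (\<omega> * (poly C1 (\<omega>\<^sup>2) + e * poly A1 (\<omega>\<^sup>2)))" for \<omega>
    unfolding c_def cpoly_add cpoly_smult evala C_def cpoly_even_odd[unfolded cpoly_add]
    by (simp add: complex_eq_iff algebra_simps)
  have ca: "0 < Re (ratfun c a (\<i> * of_real \<omega>))" for \<omega>
  proof -
    let ?s = "\<i> * complex_of_real \<omega>" and ?t = "\<omega>\<^sup>2"
    have nz: "cpoly a ?s \<noteq> 0" using hurwitz_cpoly_nz[OF a, of ?s] by simp
    then have "0 < (poly A0 ?t)\<^sup>2 + (\<omega> * poly A1 ?t)\<^sup>2"
      unfolding evala by (metis complex_neq_0 complex.sel)
    with e have "0 < e * ((poly A0 ?t)\<^sup>2 + (\<omega> * poly A1 ?t)\<^sup>2)" by simp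
    moreover have "0 \<le> poly A0 ?t * poly C0 ?t + ?t * (poly A1 ?t * poly C1 ?t)"
      using F zero_le_power2[of \<omega>] by blast
    ultimately have "0 < (poly A0 ?t * poly C0 ?t + ?t * (poly A1 ?t * poly C1 ?t)) +
        e * ((poly A0 ?t)\<^sup>2 + (\<omega> * poly A1 ?t)\<^sup>2)"
      by (rule add_nonneg_pos[rotated])
    then show ?thesis
      unfolding ratfun_def Re_divide_pos_iff[OF nz] unfolding evala evalc
      by (simp add: power2_eq_square algebra_simps)
  qed
  have cb: "0 < Re (ratfun c b (\<i> * of_real \<omega>))" for \<omega>
  proof -
    let ?s = "\<i> * complex_of_real \<omega>" and ?t = "\<omega>\<^sup>2"
    have nz: "cpoly b ?s \<noteq> 0" using hurwitz_cpoly_nz[OF b, of ?s] by simp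
    have "0 < poly (B0 * C0 + pCons 0 (B1 * C1)) ?t + e * poly G ?t"
      using e \<epsilon>(2) zero_le_power2[of \<omega>] by blast
    then show ?thesis
      unfolding ratfun_def Re_divide_pos_iff[OF nz] unfolding evalb evalc
      by (simp add: G_def power2_eq_square algebra_simps)
  qed
  have "strictly_positive_real c a \<and> strictly_positive_real c b"
    using a b ca cb deg degc by (simp add: strictly_positive_real_def m_def)
  then show ?thesis by blast
qed

theorem theorem1:
  fixes a1 a2 a3 a4 a5 a6 b1 b2 b3 b4 b5 b6 :: real
    and a b :: "real poly"
  assumes a_def: "a = [:a6, a5, a4, a3, a2, a1, 1:]"
    and b_def: "b = [:b6, b5, b4, b3, b2, b1, 1:]"
    and a_hurwitz: "a \<in> hurwitz 6"
    and b_hurwitz: "b \<in> hurwitz 6"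
  shows "(\<exists>c :: real poly. strictly_positive_real c a \<and> strictly_positive_real c b) \<longleftrightarrow>
         (\<forall>l\<in>{0..1::real}. smult l b + smult (1 - l) a \<in> hurwitz 6)"
proof -
  have deg: "degree a = 6" "degree b = 6" and lead: "lead_coeff a = lead_coeff b"
    by (simp_all add: a_def b_def)
  show ?thesis
  proof
    assume "\<exists>c. strictly_positive_real c a \<and> strictly_positive_real c b"
    then show "\<forall>l\<in>{0..1}. smult l b + smult (1 - l) a \<in> hurwitz 6"
      using hurwitz_segment_if_strictly_positive_real[OF _ _ lead] deg by fastforce
  next
    assume "\<forall>l\<in>{0..1}. smult l b + smult (1 - l) a \<in> hurwitz 6"
    \<comment> \<open>The value 2 for \<open>n\<close> gives the degree
      \<open>2 * Suc 2 = 6\<close>.\<close>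
    then show "\<exists>c. strictly_positive_real c a \<and> strictly_positive_real c b"
      using exists_strictly_positive_real_if_hurwitz_segment[of a 2 b] deg lead by simp
  qed
qed

end
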